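(* Let $(Q,\cdot)$ be a $\sigma$-generalised Bol loop with identity $e$. Let $\alpha\in BS(Q,\cdot)$ with $\alpha=\psi R_x$, where $x\in Q$ and $\psi\in SYM(Q)$ satisfies $e\psi=e$. Then there is some $g\in Q$ such that $\psi$ is a pseudo-automorphism of $(Q,\cdot)$ with companion $xg^{-1}\cdot\sigma(x)$. Moreover $\psi$ is unique: if also $\alpha=\psi'R_{x'}$ with $x'\in Q$, $\psi'\in SYM(Q)$ and $e\psi'=e$, then $\psi'=\psi$.
   Context: Juxtaposition binds more tightly than $\cdot$. Mappings are written on the right of their arguments and composed left to right; $yL_x=x\cdot y$, $yR_x=y\cdot x$. $SYM(Q)$ is the group of all permutations of $Q$. A loop $(Q,\cdot)$ with self-map $\sigma:Q\to Q$ (an arbitrary function) is a $\sigma$-generalised (right) Bol loop if $(xy\cdot z)\sigma(y)=x(yz\cdot\sigma(y))$ for all $x,y,z\in Q$. In such a loop left and right inverses coincide, and $x^{-1}$ denotes the two-sided inverse of $x$. A triple $(A,B,C)$ of bijections of $Q$ is in $AUT(Q,\cdot)$ (an autotopism) if $xA\cdot yB=(x\cdot y)C$ for all $x,y\in Q$. A bijection $A$ is a pseudo-automorphism with companion $c\in Q$ if $(A,AR_c,AR_c)\in AUT(Q,\cdot)$. The Bryant-Schneider group is $BS(Q,\cdot)=\{\theta\in SYM(Q) : \exists f,g\in Q \text{ with } (\theta R_g^{-1},\theta L_f^{-1},\theta)\in AUT(Q,\cdot)\}$. *)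

theory Defs
  imports "HOL-Algebra.Algebra"
begin

(* Only the carrier, mult and one fields of the monoid record are used; associativity is not
   assumed. *)
locale loop =
  fixes Q (structure)
  assumes m_closed: "\<lbrakk>x \<in> carrier Q; y \<in> carrier Q\<rbrakk> \<Longrightarrow> x \<otimes> y \<in> carrier Q"
    and one_closed: "\<one> \<in> carrier Q"
    and l_one: "x \<in> carrier Q \<Longrightarrow> \<one> \<otimes> x = x"
    and r_one: "x \<in> carrier Q \<Longrightarrow> x \<otimes> \<one> = x"
    and left_division: "\<lbrakk>a \<in> carrier Q; b \<in> carrier Q\<rbrakk> \<Longrightarrow> \<exists>!x. x \<in> carrier Q \<and> a \<otimes> x = b"
    and right_division: "\<lbrakk>a \<in> carrier Q; b \<in> carrier Q\<rbrakk> \<Longrightarrow> \<exists>!y. y \<in> carrier Q \<and> y \<otimes> a = b"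

locale generalised_bol_loop = loop Q for Q (structure) +
  fixes \<sigma> :: "'a \<Rightarrow> 'a"
  assumes sigma_closed: "\<sigma> \<in> carrier Q \<rightarrow> carrier Q"
    and bol_identity: "\<lbrakk>x \<in> carrier Q; y \<in> carrier Q; z \<in> carrier Q\<rbrakk> \<Longrightarrow>
      ((x \<otimes> y) \<otimes> z) \<otimes> \<sigma> y = x \<otimes> ((y \<otimes> z) \<otimes> \<sigma> y)"

(* The symmetric group on carrier Q is the library's Bij (carrier Q), whose members are undefined
   outside the carrier, so that equality of permutations is HOL equality. Products of maps act
   left to right: the product f g is compose (carrier Q) g f. *)

definition left_mult :: "('a, 'm) monoid_scheme \<Rightarrow> 'a \<Rightarrow> 'a \<Rightarrow> 'a" where
  "left_mult Q x = (\<lambda>y\<in>carrier Q. x \<otimes>\<^bsub>Q\<^esub> y)"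

definition right_mult :: "('a, 'm) monoid_scheme \<Rightarrow> 'a \<Rightarrow> 'a \<Rightarrow> 'a" where
  "right_mult Q x = (\<lambda>y\<in>carrier Q. y \<otimes>\<^bsub>Q\<^esub> x)"

definition perm_inv :: "('a, 'm) monoid_scheme \<Rightarrow> ('a \<Rightarrow> 'a) \<Rightarrow> 'a \<Rightarrow> 'a" where
  "perm_inv Q f = (\<lambda>y\<in>carrier Q. inv_into (carrier Q) f y)"

definition autotopisms ::
  "('a, 'm) monoid_scheme \<Rightarrow> (('a \<Rightarrow> 'a) \<times> ('a \<Rightarrow> 'a) \<times> ('a \<Rightarrow> 'a)) set" where
  "autotopisms Q = {(A, B, C). A \<in> Bij (carrier Q) \<and> B \<in> Bij (carrier Q) \<and> C \<in> Bij (carrier Q) \<and>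
     (\<forall>x\<in>carrier Q. \<forall>y\<in>carrier Q. A x \<otimes>\<^bsub>Q\<^esub> B y = C (x \<otimes>\<^bsub>Q\<^esub> y))}"

definition pseudo_automorphism :: "('a, 'm) monoid_scheme \<Rightarrow> ('a \<Rightarrow> 'a) \<Rightarrow> 'a \<Rightarrow> bool" where
  "pseudo_automorphism Q A c \<longleftrightarrow> A \<in> Bij (carrier Q) \<and> c \<in> carrier Q \<and>
     (A, compose (carrier Q) (right_mult Q c) A, compose (carrier Q) (right_mult Q c) A)
       \<in> autotopisms Q"

definition bryant_schneider :: "('a, 'm) monoid_scheme \<Rightarrow> ('a \<Rightarrow> 'a) set" where
  "bryant_schneider Q = {\<theta> \<in> Bij (carrier Q). \<exists>f\<in>carrier Q. \<exists>g\<in>carrier Q.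
     (compose (carrier Q) (perm_inv Q (right_mult Q g)) \<theta>,
      compose (carrier Q) (perm_inv Q (left_mult Q f)) \<theta>, \<theta>) \<in> autotopisms Q}"

lemma (in loop) left_mult_Bij:
  assumes "x \<in> carrier Q"
  shows "left_mult Q x \<in> Bij (carrier Q)"
proof -
  have "bij_betw (\<lambda>y. x \<otimes> y) (carrier Q) (carrier Q)"
    using assms m_closed left_division[OF assms]
    by (intro bij_betwI') (metis, blast, metis)
  then show ?thesis
    by (simp add: Bij_def left_mult_def)
qed

lemma (in loop) right_mult_Bij:
  assumes "x \<in> carrier Q"
  shows "right_mult Q x \<in> Bij (carrier Q)"
proof -
  have "bij_betw (\<lambda>y. y \<otimes> x) (carrier Q) (carrier Q)"
    using assms m_closed right_division[OF assms]
    by (intro bij_betwI') (metis, blast, metis)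
  then show ?thesis
    by (simp add: Bij_def right_mult_def)
qed

(* By this lemma the library's inv, a definite description of the two-sided inverse, is well
   defined in a generalised Bol loop. *)
lemma (in generalised_bol_loop) ex1_inverse:
  assumes y: "y \<in> carrier Q"
  shows "\<exists>!r. r \<in> carrier Q \<and> y \<otimes> r = \<one> \<and> r \<otimes> y = \<one>"
proof -
  obtain r where r: "r \<in> carrier Q" "y \<otimes> r = \<one>"
    using left_division[OF y one_closed] by blast
  obtain l where l: "l \<in> carrier Q" "l \<otimes> y = \<one>"
    using right_division[OF y one_closed] by blast
  have s: "\<sigma> y \<in> carrier Q" using sigma_closed y by blast
  have "r \<otimes> \<sigma> y = l \<otimes> \<sigma> y"
    using bol_identity[OF l(1) y r(1)] l r s l_one by simp
  then have "r = l"
    using right_division[OF s m_closed[OF r(1) s]] r(1) l(1) by metis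
  then show ?thesis
    using r l left_division[OF y one_closed] by blast
qed

lemma (in generalised_bol_loop) inverse:
  assumes "y \<in> carrier Q"
  shows "inv y \<in> carrier Q" "y \<otimes> inv y = \<one>" "inv y \<otimes> y = \<one>"
  using theI'[OF ex1_inverse[OF assms]] by (simp_all add: m_inv_def)

end

theory Submission
  imports Defs
begin

text \<open>
  The idea is to turn the autotopism \<open>(\<alpha> R\<^sub>g\<^sup>-\<^sup>1, \<alpha> L\<^sub>f\<^sup>-\<^sup>1, \<alpha>)\<close> witnessing \<open>\<alpha> \<in> BS(Q)\<close>, which has
  \<open>\<alpha> = \<psi> R\<^sub>x\<close> in the last place, into one with first component \<open>\<psi>\<close>. Maps compose from left to
  right here.

  Putting \<open>z = y\<^sup>-\<^sup>1\<close> in the Bol identity gives the right inverse property \<open>xy \<cdot> y\<^sup>-\<^sup>1 = x\<close>.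
  In any loop with this property, solving \<open>aA \<cdot> bB = (ab)C\<close> for \<open>aA\<close> shows that every autotopism
  \<open>(A, B, C)\<close> gives rise to the autotopism \<open>(C, JBJ, A)\<close>, where \<open>J\<close> is inversion
  (\<open>autotopism_swap\<close>). For \<open>\<alpha>\<close> this yields a triple of the form
  \<open>(\<psi> R\<^sub>x, B', \<psi> R\<^sub>x R\<^sub>g\<^sup>-\<^sup>1)\<close>. The Bol identity itself says that
  \<open>(R\<^sub>x\<^sup>-\<^sup>1, L\<^sub>x R\<^sub>\<sigma>\<^sub>(\<^sub>x\<^sub>), R\<^sub>\<sigma>\<^sub>(\<^sub>x\<^sub>))\<close> is an autotopism, and multiplying by it on the right
  cancels \<open>R\<^sub>x\<close> in the first component. By the right inverse property \<open>R\<^sub>g\<^sup>-\<^sup>1\<close> is right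
  multiplication by \<open>g\<^sup>-\<^sup>1\<close>, so the third component becomes
  \<open>\<psi> R\<^sub>x R\<^sub>h R\<^sub>\<sigma>\<^sub>(\<^sub>x\<^sub>)\<close> with \<open>h = g\<^sup>-\<^sup>1\<close>, which a second use of the Bol identity contracts to
  \<open>\<psi> R\<^sub>c\<close> with \<open>c = xg\<^sup>-\<^sup>1 \<cdot> \<sigma>(x)\<close>. An autotopism whose first component fixes the identity has equal
  second and third components, so \<open>\<psi>\<close> is a pseudo-automorphism with companion \<open>c\<close>.

  Uniqueness holds because \<open>e\<alpha> = e\<psi> \<cdot> x = x\<close>: the element \<open>x\<close>, hence also \<open>\<psi>\<close>, is
  determined by \<open>\<alpha>\<close>.
\<close>

context loop
begin

lemma right_cancel:
  "\<lbrakk>a \<in> carrier Q; b \<in> carrier Q; c \<in> carrier Q; a \<otimes> c = b \<otimes> c\<rbrakk> \<Longrightarrow> a = b"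
  using right_division[of c "b \<otimes> c"] m_closed by blast

text \<open>Evaluating the autotopism identity at the identity of the loop determines its second
  component, so it suffices to find any map in that place.\<close>

lemma pseudo_automorphismI:
  assumes \<psi>: "\<psi> \<in> Bij (carrier Q)" "\<psi> \<one> = \<one>" and c: "c \<in> carrier Q"
    and B: "\<And>z. z \<in> carrier Q \<Longrightarrow> B z \<in> carrier Q"
    and eq: "\<And>u z. \<lbrakk>u \<in> carrier Q; z \<in> carrier Q\<rbrakk> \<Longrightarrow> \<psi> u \<otimes> B z = \<psi> (u \<otimes> z) \<otimes> c"
  shows "pseudo_automorphism Q \<psi> c"
proof -
  have \<psi>_closed: "\<psi> z \<in> carrier Q" if "z \<in> carrier Q" for z
    using \<psi>(1) that Bij_imp_funcset by blast
  have "B z = \<psi> z \<otimes> c" if "z \<in> carrier Q" for z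
    using eq[OF one_closed that] \<psi>(2) that by (simp add: l_one B)
  then show ?thesis
    using \<psi>(1) c eq compose_Bij[OF right_mult_Bij[OF c] \<psi>(1)]
    by (auto simp: pseudo_automorphism_def autotopisms_def compose_def right_mult_def
        \<psi>_closed m_closed)
qed

lemma right_translation_factor_unique:
  assumes x: "x \<in> carrier Q" and x': "x' \<in> carrier Q"
    and \<psi>: "\<psi> \<in> Bij (carrier Q)" "\<psi> \<one> = \<one>"
    and \<psi>': "\<psi>' \<in> Bij (carrier Q)" "\<psi>' \<one> = \<one>"
    and eq: "compose (carrier Q) (right_mult Q x) \<psi> = compose (carrier Q) (right_mult Q x') \<psi>'"
  shows "\<psi>' = \<psi>"
proof -
  have closed: "\<psi> z \<in> carrier Q" "\<psi>' z \<in> carrier Q" if "z \<in> carrier Q" for z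
    using \<psi>(1) \<psi>'(1) that Bij_imp_funcset by blast+
  have eq': "\<psi> z \<otimes> x = \<psi>' z \<otimes> x'" if "z \<in> carrier Q" for z
    using fun_cong[OF eq, of z] that by (simp add: compose_def right_mult_def closed)
  have "x = x'"
    using eq'[OF one_closed] \<psi>(2) \<psi>'(2) x x' by (simp add: l_one)
  then have "\<psi>' z = \<psi> z" if "z \<in> carrier Q" for z
    using eq'[OF that] closed[OF that] x right_cancel by metis
  then show ?thesis
    using \<psi>(1) \<psi>'(1) by (intro extensionalityI[of _ "carrier Q"]) (auto simp: Bij_def)
qed

end

context generalised_bol_loop
begin

lemma sigma_in: "x \<in> carrier Q \<Longrightarrow> \<sigma> x \<in> carrier Q"
  using sigma_closed by blast

text \<open>This is the Bol identity at \<open>z = y\<^sup>-\<^sup>1\<close>, with the common factor \<open>\<sigma> y\<close> cancelled.\<close>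

lemma right_inverse_property:
  assumes x: "x \<in> carrier Q" and y: "y \<in> carrier Q"
  shows "(x \<otimes> y) \<otimes> inv y = x"
proof (rule right_cancel)
  show "((x \<otimes> y) \<otimes> inv y) \<otimes> \<sigma> y = x \<otimes> \<sigma> y"
    using bol_identity[OF x y inverse(1)[OF y]]
    by (simp add: inverse[OF y] l_one sigma_in[OF y])
qed (use assms in \<open>simp_all add: m_closed inverse sigma_in\<close>)

lemma inv_inv: "x \<in> carrier Q \<Longrightarrow> inv (inv x) = x"
  using right_inverse_property[of x "inv x"] inverse l_one by metis

lemma perm_inv_right_mult:
  assumes g: "g \<in> carrier Q"
  shows "perm_inv Q (right_mult Q g) = right_mult Q (inv g)"
proof
  fix y
  show "perm_inv Q (right_mult Q g) y = right_mult Q (inv g) y"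
  proof (cases "y \<in> carrier Q")
    case True
    have "(y \<otimes> inv g) \<otimes> g = y"
      using right_inverse_property[OF True inverse(1)[OF g]] by (simp add: inv_inv g)
    moreover have "inj_on (right_mult Q g) (carrier Q)"
      using right_mult_Bij[OF g] by (simp add: Bij_def bij_betw_def)
    ultimately have "inv_into (carrier Q) (right_mult Q g) y = y \<otimes> inv g"
      using True g by (intro inv_into_f_eq) (auto simp: right_mult_def m_closed inverse)
    then show ?thesis
      using True by (simp add: perm_inv_def right_mult_def)
  qed (simp add: perm_inv_def right_mult_def)
qed

text \<open>With \<open>J\<close> denoting inversion, \<open>(A, B, C)\<close> becomes \<open>(C, JBJ, A)\<close>: by the right inverse
  property, \<open>C (a \<otimes> b) = A a \<otimes> B b\<close> can be solved for \<open>A a\<close>, and the substitution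
  \<open>a = u \<otimes> z\<close>, \<open>b = z\<^sup>-\<^sup>1\<close> makes \<open>a \<otimes> b = u\<close>.\<close>

lemma autotopism_swap:
  assumes "(A, B, C) \<in> autotopisms Q" and u: "u \<in> carrier Q" and z: "z \<in> carrier Q"
  shows "C u \<otimes> inv (B (inv z)) = A (u \<otimes> z)"
proof -
  have A: "A \<in> carrier Q \<rightarrow> carrier Q" and B: "B \<in> carrier Q \<rightarrow> carrier Q"
    using assms(1) by (auto simp: autotopisms_def dest: Bij_imp_funcset)
  have "A (u \<otimes> z) \<otimes> B (inv z) = C ((u \<otimes> z) \<otimes> inv z)"
    using assms by (auto simp: autotopisms_def m_closed inverse)
  also have "\<dots> = C u"
    by (simp add: right_inverse_property u z)
  finally show ?thesis
    using right_inverse_property[of "A (u \<otimes> z)" "B (inv z)"] A B m_closed[OF u z] inverse(1)[OF z]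
    by (metis funcset_mem)
qed

text \<open>Multiplying the swapped autotopism \<open>(\<psi> R\<^sub>x, B', \<psi> R\<^sub>x R\<^sub>g\<^sup>-\<^sup>1)\<close> by the Bol autotopism at \<open>x\<close>
  leaves \<open>\<psi>\<close> in the first place.\<close>

lemma pseudo_automorphism_of_autotopism:
  assumes x: "x \<in> carrier Q" and g: "g \<in> carrier Q"
    and \<psi>: "\<psi> \<in> Bij (carrier Q)" "\<psi> \<one> = \<one>"
    and \<alpha>: "\<alpha> = compose (carrier Q) (right_mult Q x) \<psi>"
    and aut: "(compose (carrier Q) (perm_inv Q (right_mult Q g)) \<alpha>, B, \<alpha>) \<in> autotopisms Q"
  shows "pseudo_automorphism Q \<psi> ((x \<otimes> inv g) \<otimes> \<sigma> x)"
proof -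
  let ?w = "\<lambda>z. inv (B (inv z))"
  have \<psi>_closed: "\<psi> z \<in> carrier Q" if "z \<in> carrier Q" for z
    using \<psi>(1) that Bij_imp_funcset by blast
  have w_closed: "?w z \<in> carrier Q" if "z \<in> carrier Q" for z
  proof -
    have "B \<in> carrier Q \<rightarrow> carrier Q"
      using aut by (auto simp: autotopisms_def dest: Bij_imp_funcset)
    then show ?thesis
      using that by (auto intro!: inverse(1))
  qed
  have \<alpha>_eq: "\<alpha> z = \<psi> z \<otimes> x" if "z \<in> carrier Q" for z
    using that by (simp add: \<alpha> compose_def right_mult_def \<psi>_closed)
  show ?thesis
  proof (rule pseudo_automorphismI[OF \<psi>, where B = "\<lambda>z. (x \<otimes> ?w z) \<otimes> \<sigma> x"])
    fix u z assume u: "u \<in> carrier Q" and z: "z \<in> carrier Q"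
    have uz: "u \<otimes> z \<in> carrier Q"
      using u z by (rule m_closed)
    have swapped: "(\<psi> u \<otimes> x) \<otimes> ?w z = (\<psi> (u \<otimes> z) \<otimes> x) \<otimes> inv g"
      using autotopism_swap[OF aut u z] u uz x \<psi>_closed[OF uz]
      by (simp add: perm_inv_right_mult g compose_def \<alpha>_eq) (simp add: right_mult_def m_closed)
    have "\<psi> u \<otimes> ((x \<otimes> ?w z) \<otimes> \<sigma> x) = ((\<psi> u \<otimes> x) \<otimes> ?w z) \<otimes> \<sigma> x"
      using bol_identity[OF \<psi>_closed[OF u] x w_closed[OF z]] by simp
    also have "\<dots> = ((\<psi> (u \<otimes> z) \<otimes> x) \<otimes> inv g) \<otimes> \<sigma> x"
      by (simp add: swapped)
    also have "\<dots> = \<psi> (u \<otimes> z) \<otimes> ((x \<otimes> inv g) \<otimes> \<sigma> x)"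
      by (rule bol_identity[OF \<psi>_closed[OF uz] x inverse(1)[OF g]])
    finally show "\<psi> u \<otimes> ((x \<otimes> ?w z) \<otimes> \<sigma> x) = \<psi> (u \<otimes> z) \<otimes> ((x \<otimes> inv g) \<otimes> \<sigma> x)" .
  qed (use x g w_closed in \<open>simp_all add: m_closed inverse sigma_in\<close>)
qed

end

theorem theorem3p5:
  fixes Q :: "('a, 'm) monoid_scheme" (structure)
    and \<sigma> \<alpha> \<psi> :: "'a \<Rightarrow> 'a"
    and x :: 'a
  assumes "generalised_bol_loop Q \<sigma>"
    and "\<alpha> \<in> bryant_schneider Q"
    and "x \<in> carrier Q"
    and "\<psi> \<in> Bij (carrier Q)"
    and "\<psi> \<one> = \<one>"
    and "\<alpha> = compose (carrier Q) (right_mult Q x) \<psi>"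
  shows "(\<exists>g\<in>carrier Q. pseudo_automorphism Q \<psi> ((x \<otimes> inv g) \<otimes> \<sigma> x)) \<and>
    (\<forall>\<psi>' x'. x' \<in> carrier Q \<longrightarrow> \<psi>' \<in> Bij (carrier Q) \<longrightarrow> \<psi>' \<one> = \<one> \<longrightarrow>
       \<alpha> = compose (carrier Q) (right_mult Q x') \<psi>' \<longrightarrow> \<psi>' = \<psi>)"
proof (intro conjI allI impI)
  interpret generalised_bol_loop Q \<sigma> by fact
  obtain f g where g: "g \<in> carrier Q" and
    aut: "(compose (carrier Q) (perm_inv Q (right_mult Q g)) \<alpha>,
           compose (carrier Q) (perm_inv Q (left_mult Q f)) \<alpha>, \<alpha>) \<in> autotopisms Q"
    using assms(2) by (auto simp: bryant_schneider_def)
  show "\<exists>g\<in>carrier Q. pseudo_automorphism Q \<psi> ((x \<otimes> inv g) \<otimes> \<sigma> x)"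
    using pseudo_automorphism_of_autotopism[OF assms(3) g assms(4-6) aut] g by blast
  fix \<psi>' x'
  assume "x' \<in> carrier Q" "\<psi>' \<in> Bij (carrier Q)" "\<psi>' \<one> = \<one>"
    "\<alpha> = compose (carrier Q) (right_mult Q x') \<psi>'"
  then show "\<psi>' = \<psi>"
    using right_translation_factor_unique[OF assms(3) _ assms(4,5)] assms(6) by metis
qed

end
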